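(* Let $f_i:\mathbb{R}^d\to\mathbb{R}$ be differentiable, bounded from below, convex and $L_i$-smooth with $L_i>0$. Let $\gamma>0$ and $x_k\in\mathbb{R}^d$. Consider gradient descent applied to $A(z)=f_i(z)+\frac1{2\gamma}\|z-x_k\|^2$, started at $z_0=x_k$, with step size $\eta_i=\frac{\gamma}{1+\gamma L_i}$, i.e. $z_{t+1}=z_t-\eta_i\nabla A(z_t)$. Then: (a) for every $\varepsilon_1>0$, the number of iterations $t$ needed to obtain $\|z_t-\mathrm{prox}_{\gamma f_i}(x_k)\|^2\le\varepsilon_1$ is $$\mathcal{O}\left((1+\gamma L_i)\log\left(\frac{\|x_k-\mathrm{prox}_{\gamma f_i}(x_k)\|^2}{\varepsilon_1}\right)\right);$$ (b) for every $\varepsilon_2\in(0,1)$, the number of iterations $t$ needed to obtain $\|z_t-\mathrm{prox}_{\gamma f_i}(x_k)\|^2\le\varepsilon_2\|x_k-\mathrm{prox}_{\gamma f_i}(x_k)\|^2$ is $$\mathcal{O}\left((1+\gamma L_i)\log\left(\frac1{\varepsilon_2}\right)\right).$$ Here "the number of iterations needed is $\mathcal{O}(Q)$" means: there is an absolute constant $C>0$ (independent of all the data $d,f_i,L_i,\gamma,x_k,\varepsilon_1,\varepsilon_2$) such that the required inequality holds for every integer $t\ge0$ with $t\ge C\,Q$.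
   Context: $\|\cdot\|$ is the Euclidean norm. $f_i$ is $L_i$-smooth if $f_i(x)-f_i(y)-\langle\nabla f_i(y),x-y\rangle\le\frac{L_i}2\|x-y\|^2$ for all $x,y\in\mathbb{R}^d$. The proximal operator is $\mathrm{prox}_{\gamma f_i}(x)=\arg\min_{z\in\mathbb{R}^d}\{f_i(z)+\frac1{2\gamma}\|z-x\|^2\}$. Convention: $\log 0=-\infty$. *)

theory Defs
  imports "HOL-Analysis.Analysis"
begin

section \<open>Euclidean spaces of all finite dimensions inside one type\<close>

text \<open>
  The constants below must not depend on the dimension, so the dimension has to be quantified
  inside the formula and cannot be a type. Therefore \<open>\<real>\<^sup>d\<close> is the subspace \<open>Rn d\<close> of the
  inner product space of finitely supported real sequences. The norm and the inner product
  restrict to the Euclidean ones on \<open>Rn d\<close>, see \<open>norm_Rn\<close>, \<open>inner_Rn\<close> and \<open>dim_Rn\<close>.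
\<close>

typedef fseq = "{x :: nat \<Rightarrow> real. finite {i. x i \<noteq> 0}}"
  morphisms nth_fseq Abs_fseq
  by (rule exI[of _ "\<lambda>_. 0"]) simp

setup_lifting type_definition_fseq

lemma fseq_eqI: "(\<And>i. nth_fseq x i = nth_fseq y i) \<Longrightarrow> x = y"
  by transfer auto

definition supp :: "fseq \<Rightarrow> nat set" where
  "supp x = {i. nth_fseq x i \<noteq> 0}"

lemma finite_supp [simp]: "finite (supp x)"
  unfolding supp_def by transfer simp

instantiation fseq :: real_vector
begin

lift_definition zero_fseq :: fseq is "\<lambda>_. 0" by simp

lift_definition plus_fseq :: "fseq \<Rightarrow> fseq \<Rightarrow> fseq" is "\<lambda>x y i. x i + y i"
proof -
  fix x y :: "nat \<Rightarrow> real"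
  assume "finite {i. x i \<noteq> 0}" "finite {i. y i \<noteq> 0}"
  then show "finite {i. x i + y i \<noteq> 0}"
    by (rule rev_finite_subset[OF finite_UnI]) auto
qed

lift_definition uminus_fseq :: "fseq \<Rightarrow> fseq" is "\<lambda>x i. - x i" by simp

lift_definition minus_fseq :: "fseq \<Rightarrow> fseq \<Rightarrow> fseq" is "\<lambda>x y i. x i - y i"
proof -
  fix x y :: "nat \<Rightarrow> real"
  assume "finite {i. x i \<noteq> 0}" "finite {i. y i \<noteq> 0}"
  then show "finite {i. x i - y i \<noteq> 0}"
    by (rule rev_finite_subset[OF finite_UnI]) auto
qed

lift_definition scaleR_fseq :: "real \<Rightarrow> fseq \<Rightarrow> fseq" is "\<lambda>r x i. r * x i"
  by (erule rev_finite_subset) auto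

instance
  by standard (transfer; simp add: algebra_simps fun_eq_iff)+

end

lemma nth_fseq_simps [simp]:
  "nth_fseq 0 i = 0"
  "nth_fseq (x + y) i = nth_fseq x i + nth_fseq y i"
  "nth_fseq (- x) i = - nth_fseq x i"
  "nth_fseq (x - y) i = nth_fseq x i - nth_fseq y i"
  "nth_fseq (r *\<^sub>R x) i = r * nth_fseq x i"
  by (transfer; simp)+

definition fseq_inner :: "fseq \<Rightarrow> fseq \<Rightarrow> real" where
  "fseq_inner x y = (\<Sum>i\<in>supp x \<inter> supp y. nth_fseq x i * nth_fseq y i)"

lemma fseq_inner_superset:
  assumes "finite I" "supp x \<inter> supp y \<subseteq> I"
  shows "fseq_inner x y = (\<Sum>i\<in>I. nth_fseq x i * nth_fseq y i)"
  unfolding fseq_inner_def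
  by (rule sum.mono_neutral_left[OF assms]) (auto simp: supp_def)

definition fseq_norm :: "fseq \<Rightarrow> real" where
  "fseq_norm x = sqrt (fseq_inner x x)"

definition fseq_uniformity :: "(fseq \<times> fseq) filter" where
  "fseq_uniformity = (INF e\<in>{0<..}. principal {(x, y). fseq_norm (x - y) < e})"

instantiation fseq :: real_inner
begin

definition inner_fseq: "inner_fseq = fseq_inner"

definition norm_fseq: "norm_fseq = fseq_norm"

definition sgn_fseq: "sgn_fseq x = x /\<^sub>R fseq_norm x"

definition dist_fseq: "dist_fseq x y = fseq_norm (x - y)"

definition uniformity_fseq: "uniformity_fseq = fseq_uniformity"

definition open_fseq:
  "open_fseq U \<longleftrightarrow> (\<forall>x\<in>U. \<forall>\<^sub>F (x', y) in fseq_uniformity. x' = x \<longrightarrow> y \<in> U)"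

instance
proof
  fix x y z :: fseq and r :: real
  show "inner x y = inner y x"
    by (simp add: inner_fseq fseq_inner_def Int_commute mult.commute)
  show "inner (x + y) z = inner x z + inner y z"
    by (simp add: inner_fseq fseq_inner_superset[of "supp z"] sum.distrib algebra_simps)
  show "inner (r *\<^sub>R x) y = r * inner x y"
    by (simp add: inner_fseq fseq_inner_superset[of "supp y"] sum_distrib_left algebra_simps)
  show "0 \<le> inner x x"
    by (simp add: inner_fseq fseq_inner_def sum_nonneg)
  show "inner x x = 0 \<longleftrightarrow> x = 0"
  proof
    assume "inner x x = 0"
    then have "\<forall>i\<in>supp x. nth_fseq x i * nth_fseq x i = 0"
      by (simp add: inner_fseq fseq_inner_def sum_nonneg_eq_0_iff)
    then show "x = 0"
      by (intro fseq_eqI) (auto simp: supp_def)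
  qed (simp add: inner_fseq fseq_inner_def)
qed (simp_all only: inner_fseq norm_fseq sgn_fseq dist_fseq uniformity_fseq open_fseq
       fseq_norm_def fseq_uniformity_def)

end

definition Rn :: "nat \<Rightarrow> fseq set" where
  "Rn d = {x. \<forall>i\<ge>d. nth_fseq x i = 0}"

lemma subspace_Rn: "subspace (Rn d)"
  by (simp add: subspace_def Rn_def)

lemma inner_Rn:
  assumes "x \<in> Rn d"
  shows "inner x y = (\<Sum>i<d. nth_fseq x i * nth_fseq y i)"
  unfolding inner_fseq
proof (rule fseq_inner_superset)
  show "supp x \<inter> supp y \<subseteq> {..<d}"
    using assms by (force simp: supp_def Rn_def not_less[symmetric])
qed simp

lemma norm_Rn: "x \<in> Rn d \<Longrightarrow> norm x = L2_set (nth_fseq x) {..<d}"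
  by (simp add: norm_eq_sqrt_inner inner_Rn L2_set_def power2_eq_square)

lift_definition unit_fseq :: "nat \<Rightarrow> fseq" is "\<lambda>k i. if i = k then 1 else 0"
  by simp

lemma nth_unit_fseq [simp]: "nth_fseq (unit_fseq k) i = (if i = k then 1 else 0)"
  by transfer simp

lemma nth_fseq_sum: "nth_fseq (\<Sum>a\<in>A. g a) i = (\<Sum>a\<in>A. nth_fseq (g a) i)"
  by (induction A rule: infinite_finite_induct) auto

lemma dim_Rn: "dim (Rn d) = d"
proof (rule dim_unique)
  have inj: "inj_on unit_fseq {..<d}"
    by (rule inj_onI) (metis nth_unit_fseq zero_neq_one)
  show "unit_fseq ` {..<d} \<subseteq> Rn d"
    by (auto simp: Rn_def)
  show "card (unit_fseq ` {..<d}) = d"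
    using inj by (simp add: card_image)
  show "Rn d \<subseteq> span (unit_fseq ` {..<d})"
  proof
    fix x assume "x \<in> Rn d"
    then have "x = (\<Sum>k<d. nth_fseq x k *\<^sub>R unit_fseq k)"
      by (intro fseq_eqI) (auto simp: nth_fseq_sum Rn_def if_distrib cong: if_cong)
    also have "\<dots> \<in> span (unit_fseq ` {..<d})"
      by (intro span_sum span_scale span_base) auto
    finally show "x \<in> span (unit_fseq ` {..<d})" .
  qed
  have "pairwise orthogonal (unit_fseq ` {..<d})"
    by (auto simp: pairwise_def orthogonal_def inner_fseq fseq_inner_def supp_def)
  moreover have "0 \<notin> unit_fseq ` {..<d}"
    by (metis imageE nth_fseq_simps(1) nth_unit_fseq zero_neq_one)
  ultimately show "independent (unit_fseq ` {..<d})"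
    by (rule pairwise_orthogonal_independent)
qed


section \<open>Gradients, smoothness, proximal operator, gradient descent\<close>

text \<open>Here \<open>S\<close> is the space on which \<open>f\<close> lives; values of \<open>f\<close> outside \<open>S\<close> play no role.\<close>

definition grad :: "'a::real_inner set \<Rightarrow> ('a \<Rightarrow> real) \<Rightarrow> 'a \<Rightarrow> 'a" where
  "grad S f x = (THE g. g \<in> S \<and> (f has_derivative (\<lambda>h. inner g h)) (at x within S))"

definition smooth_on :: "'a::real_inner set \<Rightarrow> real \<Rightarrow> ('a \<Rightarrow> real) \<Rightarrow> bool" where
  "smooth_on S L f \<longleftrightarrow>
     (\<forall>x\<in>S. \<forall>y\<in>S. f x - f y - inner (grad S f y) (x - y) \<le> L / 2 * (norm (x - y))\<^sup>2)"

definition prox_objective :: "real \<Rightarrow> ('a::real_inner \<Rightarrow> real) \<Rightarrow> 'a \<Rightarrow> 'a \<Rightarrow> real" where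
  "prox_objective \<gamma> f x z = f z + 1 / (2 * \<gamma>) * (norm (z - x))\<^sup>2"

definition prox :: "'a::real_inner set \<Rightarrow> real \<Rightarrow> ('a \<Rightarrow> real) \<Rightarrow> 'a \<Rightarrow> 'a" where
  "prox S \<gamma> f x = arg_min_on (prox_objective \<gamma> f x) S"

primrec gradient_descent ::
  "'a::real_inner set \<Rightarrow> ('a \<Rightarrow> real) \<Rightarrow> real \<Rightarrow> 'a \<Rightarrow> nat \<Rightarrow> 'a" where
  "gradient_descent S A \<eta> z0 0 = z0"
| "gradient_descent S A \<eta> z0 (Suc t) =
     gradient_descent S A \<eta> z0 t - \<eta> *\<^sub>R grad S A (gradient_descent S A \<eta> z0 t)"

text \<open>Logarithm of a nonnegative real, with \<open>log 0 = -\<infinity>\<close> (in HOL, \<open>ln 0 = 0\<close>).\<close>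

definition eln :: "real \<Rightarrow> ereal" where
  "eln x = (if x = 0 then -\<infinity> else ereal (ln x))"

end

theory Submission
  imports Defs
begin

text \<open>
  The objective \<open>A\<close> is \<open>\<mu>\<close>-strongly convex and \<open>M\<close>-smooth with \<open>\<mu> = 1/\<gamma>\<close> and
  \<open>M = L + 1/\<gamma>\<close>, and the step size is \<open>\<eta> = 1/M\<close>. Smoothness at the next iterate \<open>z - \<eta> g\<close>
  and strong convexity at the minimiser \<open>p\<close> give
  \<open>\<langle>g, z - p\<rangle> \<ge> \<eta>/2 \<parallel>g\<parallel>\<^sup>2 + \<mu>/2 \<parallel>z - p\<parallel>\<^sup>2\<close>, hence each step multiplies the squared distance to
  \<open>p\<close> by at most \<open>1 - \<mu>/M = 1 - 1/(1 + \<gamma>L) \<le> exp (- 1/(1 + \<gamma>L))\<close>. So both constants can be \<open>1\<close>.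
\<close>

section \<open>Gradients relative to a subspace\<close>

text \<open>Along a line inside the subspace the derivative becomes an ordinary two-sided real one,
  even though the subspace may have empty interior in the ambient type. Uniqueness of gradients and
  the tangent inequality are both reduced to this.\<close>

lemma has_derivative_along_line:
  assumes S: "subspace S" and x: "x \<in> S" and v: "v \<in> S"
    and f: "(f has_derivative f') (at x within S)"
  shows "((\<lambda>t. f (x + t *\<^sub>R v)) has_real_derivative f' v) (at 0)"
proof -
  have sub: "range (\<lambda>t. x + t *\<^sub>R v) \<subseteq> S"
    using S x v by (auto intro: subspace_add subspace_scale)
  have "((\<lambda>t. x + t *\<^sub>R v) has_derivative (\<lambda>t. t *\<^sub>R v)) (at 0)"
    by (auto intro!: derivative_eq_intros)
  moreover have "(f has_derivative f') (at (x + 0 *\<^sub>R v) within range (\<lambda>t. x + t *\<^sub>R v))"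
    using has_derivative_subset[OF f sub] by simp
  ultimately have "((\<lambda>t. f (x + t *\<^sub>R v)) has_derivative (\<lambda>t. f' (t *\<^sub>R v))) (at 0)"
    by (rule has_derivative_in_compose)
  moreover have "f' (t *\<^sub>R v) = f' v * t" for t
    using linear_scale[OF has_derivative_linear[OF f]] by simp
  ultimately show ?thesis
    by (simp add: has_field_derivative_def)
qed

lemma grad_eqI:
  assumes S: "subspace S" and x: "x \<in> S" and g: "g \<in> S"
    and f: "(f has_derivative (\<lambda>h. inner g h)) (at x within S)"
  shows "grad S f x = g"
  unfolding grad_def
proof (rule the_equality)
  show "g \<in> S \<and> (f has_derivative (\<lambda>h. inner g h)) (at x within S)"
    using g f by blast
next
  fix g' assume g': "g' \<in> S \<and> (f has_derivative (\<lambda>h. inner g' h)) (at x within S)"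
  \<comment> \<open>The difference of two candidates is itself an admissible direction; testing both
    against it makes its squared norm vanish.\<close>
  have v: "g' - g \<in> S"
    using S g g' by (auto intro: subspace_diff)
  have "inner g' (g' - g) = inner g (g' - g)"
    using has_derivative_along_line[OF S x v] f g' by (blast intro: DERIV_unique)
  then have "inner (g' - g) (g' - g) = 0"
    by (simp add: inner_diff_left)
  then show "g' = g" by simp
qed

text \<open>\<open>grad\<close> is a definite description, so a representing vector has to be
  exhibited first. It is the Riesz vector of the derivative, whose coordinates are the values of
  \<open>f'\<close> on the unit vectors.\<close>

lemma grad_Rn:
  assumes f: "f differentiable_on Rn d" and x: "x \<in> Rn d"
  shows "grad (Rn d) f x \<in> Rn d"
    and "(f has_derivative (\<lambda>h. inner (grad (Rn d) f x) h)) (at x within Rn d)"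
proof -
  obtain f' where f': "(f has_derivative f') (at x within Rn d)"
    using f x unfolding differentiable_on_def differentiable_def by blast
  define g where "g = (\<Sum>i<d. f' (unit_fseq i) *\<^sub>R unit_fseq i)"
  have g: "g \<in> Rn d"
    by (auto simp: g_def Rn_def nth_fseq_sum)
  have nth_g: "nth_fseq g i = f' (unit_fseq i)" if "i < d" for i
    using that by (simp add: g_def nth_fseq_sum if_distrib cong: if_cong)
  have eq: "f' h = inner g h" if h: "h \<in> Rn d" for h
  proof -
    have "h = (\<Sum>k<d. nth_fseq h k *\<^sub>R unit_fseq k)"
      using h by (intro fseq_eqI) (auto simp: nth_fseq_sum Rn_def if_distrib cong: if_cong)
    then have "f' h = f' (\<Sum>k<d. nth_fseq h k *\<^sub>R unit_fseq k)"
      by (rule arg_cong)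
    also have "\<dots> = (\<Sum>k<d. nth_fseq h k * f' (unit_fseq k))"
      using has_derivative_linear[OF f'] by (simp add: linear_sum linear_scale)
    finally show ?thesis
      by (simp add: inner_Rn[OF g] nth_g mult.commute)
  qed
  \<comment> \<open>\<open>f'\<close> and \<open>inner g\<close> agree only on \<open>Rn d\<close>
    and may differ elsewhere. The limit defining the derivative sees only increments
    \<open>y - x\<close> in \<open>Rn d\<close>, so it carries over.\<close>
  have "((\<lambda>y. (1 / norm (y - x)) *\<^sub>R (f y - (f x + f' (y - x)))) \<longlongrightarrow> 0) (at x within Rn d)"
    using f' by (simp add: has_derivative_within)
  then have "((\<lambda>y. (1 / norm (y - x)) *\<^sub>R (f y - (f x + inner g (y - x)))) \<longlongrightarrow> 0) (at x within Rn d)"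
    by (rule Lim_transform_eventually)
       (auto simp: eventually_at_filter eq subspace_diff[OF subspace_Rn _ x])
  then have "(f has_derivative (\<lambda>h. inner g h)) (at x within Rn d)"
    by (simp add: has_derivative_within bounded_linear_inner_right)
  with g grad_eqI[OF subspace_Rn x g this]
  show "grad (Rn d) f x \<in> Rn d"
    and "(f has_derivative (\<lambda>h. inner (grad (Rn d) f x) h)) (at x within Rn d)"
    by simp_all
qed

text \<open>Restricted to the line through \<open>x\<close> and \<open>y\<close>, this is the
  one-variable tangent inequality at parameter 0, evaluated at parameter 1.\<close>

lemma convex_on_above_tangent:
  assumes S: "subspace S" and f: "convex_on S f" and x: "x \<in> S" and y: "y \<in> S"
    and f': "(f has_derivative f') (at x within S)"
  shows "f' (y - x) \<le> f y - f x"
proof -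
  define \<phi> where "\<phi> = (\<lambda>t. f (x + t *\<^sub>R (y - x)))"
  have v: "y - x \<in> S"
    using S x y by (auto intro: subspace_diff)
  have "convex_on UNIV \<phi>"
  proof (rule convex_onI)
    fix t a b :: real assume "0 < t" "t < 1"
    moreover have "x + ((1 - t) *\<^sub>R a + t *\<^sub>R b) *\<^sub>R (y - x)
        = (1 - t) *\<^sub>R (x + a *\<^sub>R (y - x)) + t *\<^sub>R (x + b *\<^sub>R (y - x))"
      by (simp add: algebra_simps)
    moreover have "x + c *\<^sub>R (y - x) \<in> S" for c
      using S x v by (auto intro: subspace_add subspace_scale)
    ultimately show "\<phi> ((1 - t) *\<^sub>R a + t *\<^sub>R b) \<le> (1 - t) * \<phi> a + t * \<phi> b"
      using convex_onD[OF f, of t] by (simp add: \<phi>_def)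
  qed simp
  moreover have "(\<phi> has_real_derivative f' (y - x)) (at 0)"
    unfolding \<phi>_def by (rule has_derivative_along_line[OF S x v f'])
  ultimately have "f' (y - x) * (1 - 0) \<le> \<phi> 1 - \<phi> 0"
    by (intro convex_on_imp_above_tangent[of UNIV]) auto
  then show ?thesis by (simp add: \<phi>_def)
qed

section \<open>The proximal objective\<close>

text \<open>A quadratic equals its second-order expansion exactly. Being an equality, this serves
  both for the upper bound (smoothness) and for the lower bound (strong convexity).\<close>

lemma prox_objective_expand:
  assumes "\<gamma> \<noteq> 0"
  shows "prox_objective \<gamma> f x w - prox_objective \<gamma> f x z - inner (v + (1 / \<gamma>) *\<^sub>R (z - x)) (w - z)
    = (f w - f z - inner v (w - z)) + 1 / (2 * \<gamma>) * (norm (w - z))\<^sup>2"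
proof -
  have "(norm (w - x))\<^sup>2 = (norm (z - x))\<^sup>2 + 2 * inner (z - x) (w - z) + (norm (w - z))\<^sup>2"
    by (simp add: power2_norm_eq_inner inner_diff inner_commute)
  moreover have "inner (v + (1 / \<gamma>) *\<^sub>R (z - x)) (w - z)
      = inner v (w - z) + inner (z - x) (w - z) / \<gamma>"
    by (simp add: inner_add_left)
  ultimately show ?thesis
    using assms by (simp add: prox_objective_def add_divide_distrib distrib_left)
qed

lemma grad_prox_objective:
  assumes S: "subspace S" and x: "x \<in> S" and z: "z \<in> S" and \<gamma>: "\<gamma> \<noteq> 0" and v: "v \<in> S"
    and f: "(f has_derivative (\<lambda>h. inner v h)) (at z within S)"
  shows "grad S (prox_objective \<gamma> f x) z = v + (1 / \<gamma>) *\<^sub>R (z - x)"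
proof (rule grad_eqI[OF S z])
  show "v + (1 / \<gamma>) *\<^sub>R (z - x) \<in> S"
    using S x z v by (intro subspace_add subspace_scale subspace_diff)
  have "(prox_objective \<gamma> f x has_derivative (\<lambda>h. inner v h + inner (z - x) h / \<gamma>)) (at z within S)"
    unfolding prox_objective_def[abs_def] power2_norm_eq_inner
    using \<gamma> by (auto intro!: derivative_eq_intros f simp: inner_commute field_simps)
  then show "(prox_objective \<gamma> f x has_derivative (\<lambda>h. inner (v + (1 / \<gamma>) *\<^sub>R (z - x)) h)) (at z within S)"
    by (simp add: inner_add_left)
qed

section \<open>Existence of the proximal point\<close>

text \<open>The ambient space is infinite-dimensional, so closed and bounded sets need not be
  compact there. Instead the box is built one coordinate at a time, as a continuous image of a
  smaller box times an interval.\<close>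

lemma compact_Rn_box: "compact {x \<in> Rn d. \<forall>i<d. \<bar>nth_fseq x i\<bar> \<le> B}"
proof (induction d)
  case 0
  have "{x \<in> Rn 0. \<forall>i<0. \<bar>nth_fseq x i\<bar> \<le> B} = {0}"
    by (auto simp: Rn_def intro: fseq_eqI)
  then show ?case by simp
next
  case (Suc d)
  let ?K = "{x \<in> Rn d. \<forall>i<d. \<bar>nth_fseq x i\<bar> \<le> B}"
  let ?h = "\<lambda>(x, r). x + r *\<^sub>R unit_fseq d"
  have "{x \<in> Rn (Suc d). \<forall>i<Suc d. \<bar>nth_fseq x i\<bar> \<le> B} = ?h ` (?K \<times> {-B..B})"
  proof (intro equalityI subsetI)
    fix x assume x: "x \<in> {x \<in> Rn (Suc d). \<forall>i<Suc d. \<bar>nth_fseq x i\<bar> \<le> B}"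
    show "x \<in> ?h ` (?K \<times> {-B..B})"
    proof (rule image_eqI)
      show "x = ?h (x - nth_fseq x d *\<^sub>R unit_fseq d, nth_fseq x d)"
        by simp
      show "(x - nth_fseq x d *\<^sub>R unit_fseq d, nth_fseq x d) \<in> ?K \<times> {-B..B}"
        using x by (auto simp: Rn_def abs_le_iff less_Suc_eq)
    qed
  next
    fix x assume "x \<in> ?h ` (?K \<times> {-B..B})"
    then show "x \<in> {x \<in> Rn (Suc d). \<forall>i<Suc d. \<bar>nth_fseq x i\<bar> \<le> B}"
      by (auto simp: Rn_def less_Suc_eq)
  qed
  moreover have "compact (?h ` (?K \<times> {-B..B}))"
    by (intro compact_continuous_image compact_Times Suc.IH compact_Icc)
       (auto simp: case_prod_unfold intro!: continuous_intros)
  ultimately show ?case by simp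
qed

lemma abs_nth_fseq_le_norm:
  assumes "x \<in> Rn d" "i < d"
  shows "\<bar>nth_fseq x i\<bar> \<le> norm x"
  using assms member_le_L2_set[of "{..<d}" i "\<lambda>i. \<bar>nth_fseq x i\<bar>"]
  by (simp add: norm_Rn L2_set_def)

text \<open>\<open>prox\<close> is a choice of minimiser, so it is meaningful only once some
  minimiser exists. The lower bound on \<open>f\<close> makes the quadratic term confine the
  sublevel set of \<open>x\<close> to a compact box.\<close>

lemma prox_Rn:
  assumes f: "continuous_on (Rn d) f" and bdd: "bdd_below (f ` Rn d)"
    and \<gamma>: "\<gamma> > 0" and x: "x \<in> Rn d"
  shows "prox (Rn d) \<gamma> f x \<in> Rn d"
    and "\<And>w. w \<in> Rn d \<Longrightarrow>
      prox_objective \<gamma> f x (prox (Rn d) \<gamma> f x) \<le> prox_objective \<gamma> f x w"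
proof -
  let ?A = "prox_objective \<gamma> f x"
  obtain m where m: "\<And>z. z \<in> Rn d \<Longrightarrow> m \<le> f z"
    using bdd by (auto simp: bdd_below_def)
  \<comment> \<open>If \<open>?A z\<close> \<le> \<open>?A x\<close> = \<open>f x\<close> and
    \<open>m\<close> \<le> \<open>f z\<close>, then \<open>z\<close> lies within
    \<open>sqrt (2 * \<gamma> * (f x - m))\<close> of \<open>x\<close>.\<close>
  define B where "B = norm x + sqrt (2 * \<gamma> * (f x - m))"
  define K where "K = {z \<in> Rn d. \<forall>i<d. \<bar>nth_fseq z i\<bar> \<le> B}"
  have sublevel: "z \<in> K" if z: "z \<in> Rn d" "?A z \<le> ?A x" for z
  proof -
    have "1 / (2 * \<gamma>) * (norm (z - x))\<^sup>2 \<le> f x - m"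
      using z m[of z] by (simp add: prox_objective_def)
    then have "(norm (z - x))\<^sup>2 \<le> 2 * \<gamma> * (f x - m)"
      using \<gamma> by (simp add: field_simps)
    then have "norm (z - x) \<le> sqrt (2 * \<gamma> * (f x - m))"
      by (rule real_le_rsqrt)
    then have "norm z \<le> B"
      using norm_triangle_ineq[of x "z - x"] by (simp add: B_def)
    then show ?thesis
      using z abs_nth_fseq_le_norm[of z d] by (force simp: K_def)
  qed
  have "continuous_on (Rn d) ?A"
    unfolding prox_objective_def[abs_def] by (intro continuous_intros f)
  then have "continuous_on K ?A"
    by (rule continuous_on_subset) (auto simp: K_def)
  moreover have "compact K"
    unfolding K_def by (rule compact_Rn_box)
  moreover have "x \<in> K"
    using sublevel x by simp
  ultimately obtain p where p: "p \<in> K" "\<And>z. z \<in> K \<Longrightarrow> ?A p \<le> ?A z"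
    using continuous_attains_inf[of K ?A] by blast
  \<comment> \<open>Either \<open>?A w\<close> \<le> \<open>?A x\<close>, and then \<open>w\<close>
    is in \<open>K\<close>, or \<open>?A w\<close> exceeds \<open>?A x\<close>, which is at least
    \<open>?A p\<close> because \<open>x\<close> is in \<open>K\<close>.\<close>
  have min: "?A p \<le> ?A w" if "w \<in> Rn d" for w
    using p sublevel[OF that] \<open>x \<in> K\<close> by (meson linear order_trans)
  have "is_arg_min ?A (\<lambda>z. z \<in> Rn d) p"
    using p(1) min by (force simp: is_arg_min_linorder K_def)
  then have "is_arg_min ?A (\<lambda>z. z \<in> Rn d) (prox (Rn d) \<gamma> f x)"
    unfolding prox_def arg_min_on_def arg_min_def by (rule someI)
  then show "prox (Rn d) \<gamma> f x \<in> Rn d"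
    and "\<And>w. w \<in> Rn d \<Longrightarrow> ?A (prox (Rn d) \<gamma> f x) \<le> ?A w"
    by (auto simp: is_arg_min_linorder)
qed

section \<open>Linear convergence\<close>

text \<open>The hypotheses are the three inequalities that one step uses, at the points
  \<open>z\<close>, \<open>p\<close> and the next iterate. This keeps the computation purely
  algebraic, free of gradients and subspaces.\<close>

lemma gradient_step_contraction:
  fixes z p g :: "'a::real_inner"
  assumes M: "M > 0"
    and smooth: "A (z - (1 / M) *\<^sub>R g) - A z - inner g (- (1 / M) *\<^sub>R g)
      \<le> M / 2 * (norm ((1 / M) *\<^sub>R g))\<^sup>2"
    and convex: "\<mu> / 2 * (norm (p - z))\<^sup>2 \<le> A p - A z - inner g (p - z)"
    and min: "A p \<le> A (z - (1 / M) *\<^sub>R g)"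
  shows "(norm (z - (1 / M) *\<^sub>R g - p))\<^sup>2 \<le> (1 - \<mu> / M) * (norm (z - p))\<^sup>2"
proof -
  have "A (z - (1 / M) *\<^sub>R g) - A z \<le> - (1 / (2 * M)) * (norm g)\<^sup>2"
  proof -
    have "M / 2 * (norm ((1 / M) *\<^sub>R g))\<^sup>2 = 1 / (2 * M) * (norm g)\<^sup>2"
      using M by (simp add: power_mult_distrib power_divide power2_eq_square)
    moreover have "inner g (- (1 / M) *\<^sub>R g) = - 2 * (1 / (2 * M) * (norm g)\<^sup>2)"
      by (simp add: power2_norm_eq_inner)
    ultimately show ?thesis using smooth by linarith
  qed
  \<comment> \<open>Chain \<open>A p\<close> \<le> \<open>A\<close> (next iterate) \<le>
    \<open>A z\<close> minus the guaranteed decrease, and insert this into the strong convexity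
    bound.\<close>
  then have "1 / (2 * M) * (norm g)\<^sup>2 + \<mu> / 2 * (norm (z - p))\<^sup>2 \<le> inner g (z - p)"
    using convex min by (simp add: norm_minus_commute[of p] inner_diff_right)
  \<comment> \<open>The factor \<open>2 / M\<close> turns the coefficient of the squared norm of
    \<open>g\<close> into \<open>1 / M\<^sup>2\<close>, which cancels the last term in the expansion
    of the new squared distance.\<close>
  then have "2 / M * (1 / (2 * M) * (norm g)\<^sup>2 + \<mu> / 2 * (norm (z - p))\<^sup>2) \<le> 2 / M * inner g (z - p)"
    using M by (intro mult_left_mono) auto
  moreover have "(norm (z - (1 / M) *\<^sub>R g - p))\<^sup>2
      = (norm (z - p))\<^sup>2 - 2 / M * inner g (z - p) + 1 / M\<^sup>2 * (norm g)\<^sup>2"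
  proof -
    have "z - (1 / M) *\<^sub>R g - p = (z - p) - (1 / M) *\<^sub>R g"
      by simp
    also have "(norm \<dots>)\<^sup>2 = (norm (z - p))\<^sup>2 - 2 * inner (z - p) ((1 / M) *\<^sub>R g) + (norm ((1 / M) *\<^sub>R g))\<^sup>2"
      by (simp only: power2_norm_eq_inner) (simp add: inner_diff inner_commute algebra_simps)
    finally show ?thesis
      by (simp add: inner_commute power_divide)
  qed
  moreover have "2 / M * (1 / (2 * M) * (norm g)\<^sup>2 + \<mu> / 2 * (norm (z - p))\<^sup>2)
      = 1 / M\<^sup>2 * (norm g)\<^sup>2 + \<mu> / M * (norm (z - p))\<^sup>2"
    by (simp add: distrib_left power2_eq_square)
  moreover have "(1 - \<mu> / M) * (norm (z - p))\<^sup>2 = (norm (z - p))\<^sup>2 - \<mu> / M * (norm (z - p))\<^sup>2"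
    by (simp add: left_diff_distrib)
  ultimately show ?thesis
    by linarith
qed

text \<open>Membership in \<open>Rn d\<close> is carried through the induction because gradients,
  smoothness and convexity are available only at points of that subspace.\<close>

lemma gradient_descent_prox_convergence:
  assumes f: "f differentiable_on Rn d" and bdd: "bdd_below (f ` Rn d)"
    and conv: "convex_on (Rn d) f" and L: "L > 0" and smooth: "smooth_on (Rn d) L f"
    and \<gamma>: "\<gamma> > 0" and x: "x \<in> Rn d"
  defines "p \<equiv> prox (Rn d) \<gamma> f x"
    and "z \<equiv> gradient_descent (Rn d) (prox_objective \<gamma> f x) (\<gamma> / (1 + \<gamma> * L)) x"
  shows "z t \<in> Rn d \<and> (norm (z t - p))\<^sup>2 \<le> (1 - 1 / (1 + \<gamma> * L)) ^ t * (norm (x - p))\<^sup>2"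
proof (induction t)
  case 0
  show ?case using x by (simp add: z_def)
next
  case (Suc t)
  let ?S = "Rn d" and ?A = "prox_objective \<gamma> f x"
  define M where "M = L + 1 / \<gamma>"
  define v where "v = grad ?S f (z t)"
  define g where "g = v + (1 / \<gamma>) *\<^sub>R (z t - x)"
  have zt: "z t \<in> ?S" using Suc.IH ..
  have M: "M > 0" using L \<gamma> by (simp add: M_def add_pos_pos)
  have v: "v \<in> ?S" and f': "(f has_derivative (\<lambda>h. inner v h)) (at (z t) within ?S)"
    using grad_Rn[OF f zt] by (simp_all add: v_def)
  have p: "p \<in> ?S" "\<And>w. w \<in> ?S \<Longrightarrow> ?A p \<le> ?A w"
    using prox_Rn[OF differentiable_imp_continuous_on[OF f] bdd \<gamma> x] by (simp_all add: p_def)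
  have "grad ?S ?A (z t) = g"
    unfolding g_def using \<gamma> by (intro grad_prox_objective subspace_Rn x zt v f') simp
  moreover have "\<gamma> / (1 + \<gamma> * L) = 1 / M"
    using \<gamma> L by (simp add: M_def field_simps)
  ultimately have step: "z (Suc t) = z t - (1 / M) *\<^sub>R g"
    by (simp add: z_def)
  have g: "g \<in> ?S"
    unfolding g_def by (intro subspace_add subspace_scale subspace_diff subspace_Rn v x zt)
  have in_S: "z t - (1 / M) *\<^sub>R g \<in> ?S"
    by (intro subspace_diff subspace_scale subspace_Rn zt g)
  have expand: "?A w - ?A (z t) - inner g (w - z t)
      = (f w - f (z t) - inner v (w - z t)) + 1 / (2 * \<gamma>) * (norm (w - z t))\<^sup>2" for w
    unfolding g_def using \<gamma> by (intro prox_objective_expand) simp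
  have "(norm (z t - (1 / M) *\<^sub>R g - p))\<^sup>2 \<le> (1 - (1 / \<gamma>) / M) * (norm (z t - p))\<^sup>2"
  proof (rule gradient_step_contraction[OF M])
    let ?w = "z t - (1 / M) *\<^sub>R g"
    have "f ?w - f (z t) - inner v (?w - z t) \<le> L / 2 * (norm (?w - z t))\<^sup>2"
      using smooth in_S zt unfolding smooth_on_def v_def by blast
    then have "?A ?w - ?A (z t) - inner g (?w - z t)
        \<le> L / 2 * (norm (?w - z t))\<^sup>2 + 1 / (2 * \<gamma>) * (norm (?w - z t))\<^sup>2"
      unfolding expand by simp
    also have "\<dots> = M / 2 * (norm (?w - z t))\<^sup>2"
      by (simp add: M_def add_divide_distrib distrib_right)
    finally show "?A ?w - ?A (z t) - inner g (- (1 / M) *\<^sub>R g) \<le> M / 2 * (norm ((1 / M) *\<^sub>R g))\<^sup>2"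
      by simp
    have "inner v (p - z t) \<le> f p - f (z t)"
      by (rule convex_on_above_tangent[OF subspace_Rn conv zt p(1) f'])
    then show "1 / \<gamma> / 2 * (norm (p - z t))\<^sup>2 \<le> ?A p - ?A (z t) - inner g (p - z t)"
      unfolding expand by (simp add: mult.commute)
    show "?A p \<le> ?A ?w"
      using p(2) in_S .
  qed
  also have "1 - (1 / \<gamma>) / M = 1 - 1 / (1 + \<gamma> * L)"
    using \<gamma> by (simp add: M_def field_simps)
  \<comment> \<open>Multiplying the induction hypothesis by the contraction factor is allowed since
    \<open>1 + \<gamma> * L\<close> > 1 makes that factor positive.\<close>
  also have "(1 - 1 / (1 + \<gamma> * L)) * (norm (z t - p))\<^sup>2
      \<le> (1 - 1 / (1 + \<gamma> * L)) * ((1 - 1 / (1 + \<gamma> * L)) ^ t * (norm (x - p))\<^sup>2)"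
    using Suc.IH \<gamma> L by (intro mult_left_mono) (auto simp: field_simps add_pos_pos)
  finally show ?case
    using in_S by (simp add: step)
qed

section \<open>From the contraction rate to iteration counts\<close>

text \<open>From \<open>1 - s\<close> \<le> \<open>exp (- s)\<close> the power is at most
  \<open>exp (- t / \<kappa>)\<close>; \<open>\<kappa>\<close> \<ge> 1 keeps the base nonnegative,
  so that powers are monotone.\<close>

lemma power_one_minus_inverse_le:
  fixes \<kappa> \<delta> :: real
  assumes "\<kappa> \<ge> 1" "\<delta> > 0" and t: "\<kappa> * ln (1 / \<delta>) \<le> real t"
  shows "(1 - 1 / \<kappa>) ^ t \<le> \<delta>"
proof -
  have "(1 - 1 / \<kappa>) ^ t \<le> exp (- 1 / \<kappa>) ^ t"
    using assms(1) exp_ge_add_one_self[of "- 1 / \<kappa>"] by (intro power_mono) auto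
  also have "\<dots> = exp (- real t / \<kappa>)"
    by (simp flip: exp_of_nat_mult)
  also have "- real t / \<kappa> \<le> ln \<delta>"
    using assms by (simp add: ln_div field_simps)
  finally show ?thesis
    using assms(2) by simp
qed

theorem theorem4:
  shows "\<exists>C1 C2 :: real. C1 > 0 \<and> C2 > 0 \<and>
    (\<forall>(d::nat) (f :: fseq \<Rightarrow> real) (L::real) (\<gamma>::real) (xk::fseq).
       f differentiable_on Rn d \<longrightarrow>
       bdd_below (f ` Rn d) \<longrightarrow>
       convex_on (Rn d) f \<longrightarrow>
       L > 0 \<longrightarrow>
       smooth_on (Rn d) L f \<longrightarrow>
       \<gamma> > 0 \<longrightarrow>
       xk \<in> Rn d \<longrightarrow>
       (let p = prox (Rn d) \<gamma> f xk;
            \<eta> = \<gamma> / (1 + \<gamma> * L);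
            z = gradient_descent (Rn d) (prox_objective \<gamma> f xk) \<eta> xk
        in (\<forall>\<epsilon>1>0. \<forall>t::nat.
              ereal (real t) \<ge> ereal C1 * (ereal (1 + \<gamma> * L) * eln ((norm (xk - p))\<^sup>2 / \<epsilon>1)) \<longrightarrow>
              (norm (z t - p))\<^sup>2 \<le> \<epsilon>1) \<and>
           (\<forall>\<epsilon>2. 0 < \<epsilon>2 \<and> \<epsilon>2 < 1 \<longrightarrow> (\<forall>t::nat.
              real t \<ge> C2 * ((1 + \<gamma> * L) * ln (1 / \<epsilon>2)) \<longrightarrow>
              (norm (z t - p))\<^sup>2 \<le> \<epsilon>2 * (norm (xk - p))\<^sup>2))))"
proof (rule exI[of _ 1], rule exI[of _ 1], intro conjI allI impI)
  fix d :: nat and f :: "fseq \<Rightarrow> real" and L \<gamma> :: real and xk :: fseq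
  assume hyps: "f differentiable_on Rn d" "bdd_below (f ` Rn d)" "convex_on (Rn d) f" "L > 0"
    "smooth_on (Rn d) L f" "\<gamma> > 0" "xk \<in> Rn d"
  define p where "p = prox (Rn d) \<gamma> f xk"
  define z where "z = gradient_descent (Rn d) (prox_objective \<gamma> f xk) (\<gamma> / (1 + \<gamma> * L)) xk"
  define \<kappa> where "\<kappa> = 1 + \<gamma> * L"
  define D where "D = (norm (xk - p))\<^sup>2"
  have conv: "(norm (z t - p))\<^sup>2 \<le> (1 - 1 / \<kappa>) ^ t * D" for t
    using gradient_descent_prox_convergence[OF hyps] unfolding z_def p_def \<kappa>_def D_def by blast
  have \<kappa>: "\<kappa> \<ge> 1" using hyps by (simp add: \<kappa>_def)
  have D: "D \<ge> 0" by (simp add: D_def)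
  \<comment> \<open>Here \<open>\<delta>\<close> may be 1 or larger: the absolute bound below takes
    \<open>\<delta>\<close> = \<open>\<epsilon> / D\<close>, which is not bounded by 1.\<close>
  have relative: "(norm (z t - p))\<^sup>2 \<le> \<delta> * D" if "\<delta> > 0" "\<kappa> * ln (1 / \<delta>) \<le> real t" for \<delta> t
    using conv[of t] mult_right_mono[OF power_one_minus_inverse_le[OF \<kappa> that] D] by linarith
  have absolute: "(norm (z t - p))\<^sup>2 \<le> \<epsilon>"
    if "\<epsilon> > 0" and t: "ereal 1 * (ereal \<kappa> * eln (D / \<epsilon>)) \<le> ereal (real t)" for \<epsilon> t
  proof (cases "D = 0")
    case True
    then show ?thesis using conv[of t] \<open>\<epsilon> > 0\<close> by simp
  next
    case False
    then have "\<kappa> * ln (1 / (\<epsilon> / D)) \<le> real t"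
      using t \<open>\<epsilon> > 0\<close> by (simp add: eln_def)
    then show ?thesis
      using relative[of "\<epsilon> / D" t] False D \<open>\<epsilon> > 0\<close> by simp
  qed
  show "let p = prox (Rn d) \<gamma> f xk;
            \<eta> = \<gamma> / (1 + \<gamma> * L);
            z = gradient_descent (Rn d) (prox_objective \<gamma> f xk) \<eta> xk
        in (\<forall>\<epsilon>1>0. \<forall>t::nat.
              ereal (real t) \<ge> ereal 1 * (ereal (1 + \<gamma> * L) * eln ((norm (xk - p))\<^sup>2 / \<epsilon>1)) \<longrightarrow>
              (norm (z t - p))\<^sup>2 \<le> \<epsilon>1) \<and>
           (\<forall>\<epsilon>2. 0 < \<epsilon>2 \<and> \<epsilon>2 < 1 \<longrightarrow> (\<forall>t::nat.
              real t \<ge> 1 * ((1 + \<gamma> * L) * ln (1 / \<epsilon>2)) \<longrightarrow>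
              (norm (z t - p))\<^sup>2 \<le> \<epsilon>2 * (norm (xk - p))\<^sup>2))"
    using absolute relative unfolding Let_def p_def z_def \<kappa>_def D_def by simp
qed simp_all

end
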